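(* For all $n\ge 2$, \[ g_n=\sum_{j=1}^{n-1} b_{n,j}\,(q-1)^{j-1} g_{n-j}, \qquad\text{where}\qquad b_{n,j}=\sum_{k=0}^{n-1-j}\frac{n-1+j-k}{j}\binom{j+k-2}{j-2}\binom{n-2-k}{j-1}q^k . \]
   Context: Let $\mathcal S_n$ be the set of permutations of $\{1,\dots,n\}$. The standard cycle form of $\sigma\in\mathcal S_n$ writes $\sigma$ as a product of disjoint cycles (fixed points included as 1-cycles), each cycle written starting with its smallest letter, and the cycles arranged in increasing order of their smallest letters. $\mathrm{Flatten}(\sigma)$ is the word of length $n$ obtained by erasing the parentheses in the standard cycle form of $\sigma$. An occurrence of the pattern 13-2 in a word $w_1\cdots w_n$ is a pair of indices $(i,j)$ with $2\le i<j\le n$ and $w_{i-1}<w_j<w_i$. Define the polynomial $g_n=\sum_{\pi\in\mathcal S_n} q^{\text{number of occurrences of 13-2 in }\mathrm{Flatten}(\pi)}$ (so $g_1=1$). Binomial coefficients $\binom{a}{b}$ with $b<0$ or $b>a\ge 0$ are $0$; in particular for $j=1$ one uses the convention $\binom{k-1}{-1}=\chi(k=0)$ (only the $k=0$ term survives with coefficient $\frac{n}{1}\cdot 1$), consistent with $b_{n,1}=n$. *)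

theory Defs
  imports
    "HOL-Combinatorics.Combinatorics"
    "HOL-Computational_Algebra.Polynomial"
begin

text \<open>
  A permutation of \<open>{1..n}\<close> is a function \<open>p\<close> with \<open>p permutes {1..n}\<close>. The library's
  \<open>support p a\<close> is the list \<open>[a, p a, p (p a), ...]\<close>, stopping just before the first
  return to \<open>a\<close>: it is the cycle of \<open>p\<close> through \<open>a\<close>, written starting with \<open>a\<close>
  (and \<open>[a]\<close> if \<open>a\<close> is a fixed point).
\<close>

definition standard_cycle_form :: "nat \<Rightarrow> (nat \<Rightarrow> nat) \<Rightarrow> nat list list" where
  "standard_cycle_form n p =
     map (support p) (filter (\<lambda>a. \<forall>b\<in>set (support p a). a \<le> b) [1..<Suc n])"

definition Flatten :: "nat \<Rightarrow> (nat \<Rightarrow> nat) \<Rightarrow> nat list" where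
  "Flatten n p = concat (standard_cycle_form n p)"

text \<open>
  Words are indexed from 1, so the letter \<open>w\<^sub>i\<close> is the list entry \<open>w ! (i - 1)\<close>.
\<close>

definition letter :: "nat list \<Rightarrow> nat \<Rightarrow> nat" where
  "letter w i = w ! (i - 1)"

definition occ_13_2 :: "nat list \<Rightarrow> nat" where
  "occ_13_2 w = card {(i, j). 2 \<le> i \<and> i < j \<and> j \<le> length w \<and>
                         letter w (i - 1) < letter w j \<and> letter w j < letter w i}"

text \<open>
  The identity is one of polynomials in the formal variable \<open>q\<close>. The coefficients are
  rational because of the factors \<open>(n - 1 + j - k) / j\<close>.
\<close>

definition q :: "rat poly" where
  "q = [:0, 1:]"

definition g :: "nat \<Rightarrow> rat poly" where
  "g n = (\<Sum>p | p permutes {1..n}. q ^ occ_13_2 (Flatten n p))"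

text \<open>
  Binomial coefficients vanish outside \<open>0 \<le> b \<le> a\<close>, with the single exception that
  \<open>-1\<close> over \<open>-1\<close> is 1. This is the convention that \<open>k - 1\<close> over \<open>-1\<close> is 1 for
  \<open>k = 0\<close> and 0 for \<open>k > 0\<close>. The case \<open>a < 0 \<le> b\<close> never arises in \<open>b_coeff\<close>.
\<close>

definition binom :: "int \<Rightarrow> int \<Rightarrow> nat" where
  "binom a b =
     (if a = -1 \<and> b = -1 then 1
      else if 0 \<le> b \<and> b \<le> a then nat a choose nat b
      else 0)"

text \<open>
  Only \<open>1 \<le> j \<le> n - 1\<close> is relevant; there the natural number subtraction in the upper
  summation bound does not truncate. The other differences are taken in \<open>rat\<close> and \<open>int\<close>.
\<close>

definition b_coeff :: "nat \<Rightarrow> nat \<Rightarrow> rat poly" where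
  "b_coeff n j =
     (\<Sum>k = 0..n - 1 - j.
        smult ((of_nat n - 1 + of_nat j - of_nat k) / of_nat j
               * of_nat (binom (int j + int k - 2) (int j - 2))
               * of_nat (binom (int n - 2 - int k) (int j - 1)))
          (q ^ k))"

end

theory Submission
  imports Defs
begin

text \<open>
  The cycles of \<open>\<sigma>\<close> start at the letter 1 and at an arbitrary subset of the other right-to-left
  minima of \<open>Flatten \<sigma>\<close>. So \<open>g n\<close> sums \<open>2\<^sup>s\<close> times a power of \<open>q\<close> over the words on \<open>{2..n}\<close>,
  with \<open>s\<close> the number of right-to-left minima. Removing letters from the left gives a recursion
  for the generating function \<open>G m r\<close> (\<open>word_gf\<close> below) of the words on \<open>m\<close> letters that follow a
  letter of rank \<open>r\<close>. With \<open>d m r = G m (r + 1) - G m r\<close> the recursion becomes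
  \<open>q d(m + 1, r) = d(m + 1, r - 1) + (q - 1) G m r\<close>, which expands \<open>q\<^sup>r G m r\<close> and
  \<open>q\<^sup>r\<^sup>+\<^sup>1 d m r\<close> in terms of the values \<open>G (m - j) 0 = g (m - j + 1)\<close>, starting from \<open>r = 0\<close>.
  The theorem is the boundary condition \<open>d(m + 1, m) = 0\<close> divided by \<open>q - 1\<close>.
\<close>

section \<open>Flattened permutations and weighted words\<close>

lemma successively_support:
  assumes "permutation p"
  shows "successively (\<lambda>y z. p y = z) (support p a @ [a])"
proof -
  have "support p a @ [a] = map (\<lambda>i. (p ^^ i) a) [0..<Suc (least_power p a)]"
    using least_power_of_permutation(1)[OF assms, of a] by simp
  moreover have "successively (\<lambda>y z. p y = z) (map (\<lambda>i. (p ^^ i) a) [0..<Suc k])" for k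
    unfolding successively_conv_nth by (auto simp del: upt_Suc)
  ultimately show ?thesis by metis
qed

text \<open>A return to \<open>a\<close> before \<open>length xs\<close> steps would repeat the
  entry at index 0, so the closed walk \<open>xs\<close> is the whole cycle. This identifies cycles
  of a modified permutation without computing its powers.\<close>

lemma support_eqI:
  assumes "distinct xs" "xs \<noteq> []" "hd xs = a"
    and succ: "successively (\<lambda>y z. p y = z) (xs @ [a])"
  shows "support p a = xs"
proof -
  have pow: "(p ^^ i) a = (xs @ [a]) ! i" if "i \<le> length xs" for i
    using that
  proof (induction i)
    case 0
    then show ?case using assms(2,3) by (simp add: hd_conv_nth nth_append)
  next
    case (Suc i)
    then have "p ((xs @ [a]) ! i) = (xs @ [a]) ! Suc i"
      using successively_nth[OF succ, of i] by simp
    with Suc show ?case by simp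
  qed
  have "least_power p a = length xs"
    unfolding least_power_def
  proof (rule Least_equality)
    show "(p ^^ length xs) a = a \<and> 0 < length xs"
      using pow[of "length xs"] assms(2) by simp
  next
    fix k assume k: "(p ^^ k) a = a \<and> 0 < k"
    show "length xs \<le> k"
    proof (rule ccontr)
      assume "\<not> length xs \<le> k"
      then have "xs ! k = xs ! 0"
        using pow[of k] pow[of 0] k assms(2) by (auto simp: nth_append)
      with \<open>\<not> length xs \<le> k\<close> k assms(1) show False
        using nth_eq_iff_index_eq[OF assms(1), of k 0] assms(2) by auto
    qed
  qed
  then show ?thesis
    by (intro nth_equalityI) (auto simp: pow nth_append)
qed

lemma support_simps:
  assumes "permutation p"
  shows "support p a \<noteq> []" "hd (support p a) = a"
  using least_power_of_permutation(2)[OF assms, of a] by (auto simp: hd_map)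

text \<open>The block form commutes with \<open>concat\<close> and leaves words without
  \<open>x\<close> unchanged, so one insertion can be applied to all cycles at once.\<close>

definition insert_after :: "'a \<Rightarrow> 'a \<Rightarrow> 'a list \<Rightarrow> 'a list" where
  "insert_after x z w = concat (map (\<lambda>y. if y = x then [x, z] else [y]) w)"

lemma insert_after_simps [simp]:
  "insert_after x z [] = []"
  "insert_after x z (y # w) =
    (if y = x then x # z # insert_after x z w else y # insert_after x z w)"
  by (simp_all add: insert_after_def)

lemma insert_after_concat:
  "insert_after x z (concat ws) = concat (map (insert_after x z) ws)"
  by (induction ws) (simp_all add: insert_after_def)

lemma set_insert_after:
  "set (insert_after x z w) = set w \<union> (if x \<in> set w then {z} else {})"
  by (induction w) auto

lemma distinct_insert_after:
  "distinct w \<Longrightarrow> z \<notin> set w \<Longrightarrow> distinct (insert_after x z w)"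
  by (induction w) (auto simp: set_insert_after)

lemma hd_insert_after: "hd (insert_after x z w @ ys) = hd (w @ ys)"
  by (cases w) auto

lemma insert_after_eq_Nil [simp]: "insert_after x z w = [] \<longleftrightarrow> w = []"
  by (cases w) auto

lemma insert_after_notin: "x \<notin> set w \<Longrightarrow> insert_after x z w = w"
  by (induction w) auto

lemma insert_after_nth:
  "distinct w \<Longrightarrow> i < length w \<Longrightarrow>
    insert_after (w ! i) z w = take (Suc i) w @ z # drop (Suc i) w"
proof (induction w arbitrary: i)
  case (Cons y w)
  then show ?case
    by (cases i) (auto simp: insert_after_notin)
qed simp

lemma successively_insert_after:
  assumes "successively (\<lambda>y z. p y = z) (w @ [a])" "n \<notin> set w" "x \<noteq> n"
  shows "successively (\<lambda>y z. (p(x := n, n := p x)) y = z) (insert_after x n w @ [a])"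
  using assms
  by (induction w) (auto simp: successively_Cons hd_insert_after)

text \<open>The new map sends \<open>x\<close> to \<open>n\<close> and \<open>n\<close> to
  \<open>p x\<close>: the walk makes a detour through \<open>n\<close> if it passes
  \<open>x\<close>, and is unchanged otherwise.\<close>

lemma support_insert_after:
  assumes p: "permutation p" and n: "n \<notin> set (support p a)" "x \<noteq> n"
  shows "support (p(x := n, n := p x)) a = insert_after x n (support p a)"
proof (rule support_eqI)
  show "distinct (insert_after x n (support p a))"
    using cycle_of_permutation[OF p] n by (intro distinct_insert_after)
  show "insert_after x n (support p a) \<noteq> []"
    using support_simps[OF p, of a] by simp
  show "hd (insert_after x n (support p a)) = a"
    using hd_insert_after[of x n "support p a" "[]"] support_simps(2)[OF p] by simp
  show "successively (\<lambda>y z. (p(x := n, n := p x)) y = z) (insert_after x n (support p a) @ [a])"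
    by (rule successively_insert_after[OF successively_support[OF p] n])
qed

lemma support_subset:
  assumes "p permutes S" "finite S" "a \<in> S"
  shows "set (support p a) \<subseteq> S"
proof -
  have "(p ^^ i) a \<in> S" for i
    using permutes_in_image[OF permutes_funpow[OF assms(1)], of i a] assms(3) by blast
  then show ?thesis by auto
qed

text \<open>Links the parametrisation \<open>transpose n b \<circ> p\<close> of the permutations of
  \<open>insert n S\<close> with cycle insertion: \<open>b = p x\<close> puts \<open>n\<close>
  between \<open>x\<close> and its image.\<close>

lemma transpose_comp_permutes:
  assumes "p permutes S" "n \<notin> S" "x \<in> S"
  shows "transpose n (p x) \<circ> p = p(x := n, n := p x)"
proof
  fix y
  have "p n = n" using assms by (simp add: permutes_def)
  moreover have "p y = p x \<longleftrightarrow> y = x" "p y = n \<longleftrightarrow> y = n"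
    using permutes_inj[OF assms(1)] \<open>p n = n\<close> by (metis injD)+
  ultimately show "(transpose n (p x) \<circ> p) y = (p(x := n, n := p x)) y"
    using assms by (auto simp: transpose_def)
qed

lemma Flatten_insert_fixed:
  assumes p: "p permutes {1..m}"
  shows "Flatten (Suc m) p = Flatten m p @ [Suc m]"
proof -
  have "support p (Suc m) = [Suc m]"
    using p by (intro support_eqI) (auto simp: permutes_def)
  moreover from this have "\<forall>b\<in>set (support p (Suc m)). Suc m \<le> b"
    by (simp only: list.set) simp
  ultimately show ?thesis
    unfolding Flatten_def standard_cycle_form_def by (simp del: set_map)
qed

text \<open>The greatest letter, put into an existing cycle, changes no cycle minimum and opens no
  cycle, so the cycles keep their order.\<close>

lemma Flatten_insert_after:
  assumes p: "p permutes {1..m}" and x: "x \<in> {1..m}"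
  shows "Flatten (Suc m) (transpose (Suc m) (p x) \<circ> p) = insert_after x (Suc m) (Flatten m p)"
proof -
  define r where "r = transpose (Suc m) (p x) \<circ> p"
  have r: "r = p(x := Suc m, Suc m := p x)"
    unfolding r_def using p x by (intro transpose_comp_permutes) auto
  have pp: "permutation p" using p permutation_permutes by blast
  have pr: "permutation r"
    unfolding r_def by (intro permutation_compose permutation_swap_id pp)
  have sup: "support r a = insert_after x (Suc m) (support p a)" if "a \<in> {1..m}" for a
    unfolding r using support_subset[OF p _ that] x
    by (intro support_insert_after[OF pp]) auto
  \<comment> \<open>One application of \<open>r\<close> leads from \<open>Suc m\<close> to the
    smaller letter \<open>p x\<close>, so \<open>Suc m\<close> is not the minimum of its
    cycle.\<close>
  have "r (Suc m) \<in> set (support r (Suc m))"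
    using support_set[OF pr, of "Suc m"] by (auto intro!: range_eqI[of _ _ 1])
  moreover have "r (Suc m) < Suc m"
    using permutes_in_image[OF p, of x] x by (simp add: r)
  ultimately have last: "\<not> (\<forall>b\<in>set (support r (Suc m)). Suc m \<le> b)"
    by (meson not_le)
  have "filter (\<lambda>a. \<forall>b\<in>set (support r a). a \<le> b) [1..<Suc m] =
      filter (\<lambda>a. \<forall>b\<in>set (support p a). a \<le> b) [1..<Suc m]"
  proof (rule filter_cong[OF refl])
    fix a assume "a \<in> set [1..<Suc m]"
    then have "a \<in> {1..m}" by auto
    then show "(\<forall>b\<in>set (support r a). a \<le> b) = (\<forall>b\<in>set (support p a). a \<le> b)"
      unfolding sup[OF \<open>a \<in> {1..m}\<close>] set_insert_after by auto
  qed
  then have "standard_cycle_form (Suc m) r =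
      map (support r) (filter (\<lambda>a. \<forall>b\<in>set (support p a). a \<le> b) [1..<Suc m])"
    unfolding standard_cycle_form_def using last by (simp del: set_map)
  also have "\<dots> = map (insert_after x (Suc m)) (standard_cycle_form m p)"
    unfolding standard_cycle_form_def map_map o_def
    by (rule map_cong[OF refl], rule sup) auto
  finally show ?thesis
    unfolding Flatten_def r_def[symmetric] insert_after_concat by simp
qed

section \<open>Words weighted by their right-to-left minima\<close>

fun rl_weight :: "nat list \<Rightarrow> nat" where
  "rl_weight [] = 1"
| "rl_weight (x # w) = (if \<forall>y\<in>set w. x < y then 2 else 1) * rl_weight w"

text \<open>A greatest letter is a right-to-left minimum only at the end of the word, and it never
  spoils this property for a letter before it.\<close>

lemma rl_weight_insert_greatest:
  assumes "\<forall>x\<in>set (xs @ ys). x < z"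
  shows "rl_weight (xs @ z # ys) = (if ys = [] then 2 else 1) * rl_weight (xs @ ys)"
  using assms
proof (induction xs)
  case Nil
  then show ?case by (cases ys) auto
next
  case (Cons x xs)
  then show ?case by auto
qed

text \<open>An arrangement corresponds to what is left on deleting \<open>z\<close>, together with
  the position of \<open>z\<close>, which the length of the \<open>takeWhile\<close> prefix
  recovers.\<close>

lemma sum_permutations_of_set_insert:
  assumes "z \<notin> A"
  shows "(\<Sum>w\<in>permutations_of_set (insert z A). F w) =
    (\<Sum>u\<in>permutations_of_set A. \<Sum>i\<le>length u. F (take i u @ z # drop i u))"
proof -
  have tw: "length (takeWhile (\<lambda>y. y \<noteq> z) (us @ z # vs)) = length us"
    if "z \<notin> set us" for us vs
    using that by (induction us) auto
  have "(\<Sum>u\<in>permutations_of_set A. \<Sum>i\<le>length u. F (take i u @ z # drop i u)) =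
      (\<Sum>(u, i)\<in>Sigma (permutations_of_set A) (\<lambda>u. {..length u}). F (take i u @ z # drop i u))"
    by (rule sum.Sigma) auto
  also have "\<dots> = (\<Sum>w\<in>permutations_of_set (insert z A). F w)"
  proof (rule sum.reindex_bij_witness
      [where i = "\<lambda>w. (remove1 z w, length (takeWhile (\<lambda>y. y \<noteq> z) w))"
        and j = "\<lambda>(u, i). take i u @ z # drop i u"], goal_cases)
    case (1 a)
    then obtain u i where a: "a = (u, i)" "set u = A" "distinct u" "i \<le> length u"
      by (auto dest: permutations_of_setD)
    then have "z \<notin> set (take i u)" using assms by (meson in_set_takeD)
    then show ?case using a tw[of "take i u" "drop i u"] by (simp add: remove1_append)
  next
    case (2 a)
    then obtain u i where a: "a = (u, i)" "set u = A" "distinct u" "i \<le> length u"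
      by (auto dest: permutations_of_setD)
    define us vs where "us = take i u" and "vs = drop i u"
    have "u = us @ vs" by (simp add: us_def vs_def)
    then have "set (us @ z # vs) = insert z A" "distinct (us @ z # vs)"
      using a(2,3) assms by auto
    then show ?case
      unfolding a(1) prod.case us_def vs_def by (rule permutations_of_setI)
  next
    case (3 w)
    then have w: "set w = insert z A" "distinct w" by (auto dest: permutations_of_setD)
    then obtain us vs where s: "w = us @ z # vs"
      using split_list[of z w] by auto
    then show ?case using w tw[of us vs] by (simp add: remove1_append)
  next
    case (4 w)
    then have w: "set w = insert z A" "distinct w" by (auto dest: permutations_of_setD)
    then obtain us vs where s: "w = us @ z # vs"
      using split_list[of z w] by auto
    with w have z: "z \<notin> set us" "z \<notin> set vs" by auto
    then have "set (us @ vs) = A" "distinct (us @ vs)" using w assms unfolding s by auto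
    then have "us @ vs \<in> permutations_of_set A" by (rule permutations_of_setI)
    then show ?case unfolding s using z by (simp add: remove1_append tw)
  next
    case (5 a)
    then show ?case by auto
  qed
  finally show ?thesis ..
qed

text \<open>
  Inserting \<open>n = m + 2\<close> after any letter of the flattening corresponds to one permutation, except
  that at the end of the word there is a second one, in which \<open>n\<close> is a fixed point.
\<close>

lemma sum_Flatten:
  fixes F :: "nat list \<Rightarrow> 'a :: comm_semiring_1"
  shows "(\<Sum>p | p permutes {1..Suc m}. F (Flatten (Suc m) p)) =
    (\<Sum>u\<in>permutations_of_set {2..Suc m}. of_nat (rl_weight u) * F (1 # u))"
proof (induction m arbitrary: F)
  case 0
  have "Flatten 1 id = [1]"
    using Flatten_insert_fixed[of id 0] by (simp add: Flatten_def standard_cycle_form_def)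
  then show ?case by (simp add: permutes_sing id_def)
next
  case (Suc m)
  define n where "n = Suc (Suc m)"
  define S where "S = {1..Suc m}"
  define A where "A = {2..Suc m}"
  \<comment> \<open>Collects all extensions of one permutation: \<open>n\<close> fixed, or inserted
    after some \<open>x\<close>. The induction hypothesis is applied to \<open>F'\<close>, which is
    why \<open>F\<close> is arbitrary.\<close>
  define F' where "F' w = F (w @ [n]) + (\<Sum>x\<in>S. F (insert_after x n w))" for w
  have n: "{1..n} = insert n S" "n \<notin> S" "{2..n} = insert n A" "n \<notin> A"
    by (auto simp: n_def S_def A_def)
  have F': "F' (1 # u) = F (1 # u @ [n]) + (\<Sum>i\<le>length u. F (1 # take i u @ n # drop i u))"
    if u: "u \<in> permutations_of_set A" for u
  proof -
    have d: "distinct (1 # u)" and s: "set (1 # u) = S"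
      using permutations_of_setD[OF u] by (auto simp: A_def S_def)
    have "(\<Sum>x\<in>S. F (insert_after x n (1 # u))) =
        (\<Sum>i<length (1 # u). F (insert_after ((1 # u) ! i) n (1 # u)))"
      using sum.reindex_bij_betw[OF bij_betw_nth[OF d refl s[symmetric]],
          of "\<lambda>x. F (insert_after x n (1 # u))"] by simp
    also have "\<dots> = (\<Sum>i<length (1 # u). F (take (Suc i) (1 # u) @ n # drop (Suc i) (1 # u)))"
      by (intro sum.cong refl arg_cong[of _ _ F] insert_after_nth[OF d]) simp
    also have "\<dots> = (\<Sum>i\<le>length u. F (1 # take i u @ n # drop i u))"
      by (simp add: lessThan_Suc_atMost)
    finally show ?thesis unfolding F'_def by simp
  qed
  have step: "F (Flatten n (transpose n n \<circ> p)) + (\<Sum>b\<in>S. F (Flatten n (transpose n b \<circ> p)))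
      = F' (Flatten (Suc m) p)" if p: "p permutes S" for p
  proof -
    \<comment> \<open>Substituting \<open>b = p x\<close> turns the transpositions into insertions
      after \<open>x\<close>.\<close>
    have "(\<Sum>b\<in>S. F (Flatten n (transpose n b \<circ> p))) =
        (\<Sum>x\<in>S. F (Flatten n (transpose n (p x) \<circ> p)))"
      by (rule sum.reindex_bij_betw[symmetric, OF permutes_imp_bij[OF p]])
    also have "\<dots> = (\<Sum>x\<in>S. F (insert_after x n (Flatten (Suc m) p)))"
      using p unfolding n_def S_def
      by (intro sum.cong refl arg_cong[of _ _ F] Flatten_insert_after) auto
    finally show ?thesis
      using Flatten_insert_fixed[of p "Suc m"] p by (simp add: F'_def n_def S_def)
  qed
  have "(\<Sum>p | p permutes {1..n}. F (Flatten n p)) =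
      (\<Sum>b\<in>insert n S. \<Sum>p | p permutes S. F (Flatten n (transpose n b \<circ> p)))"
    unfolding n(1) by (rule sum_over_permutations_insert) (use n in \<open>auto simp: S_def\<close>)
  also have "\<dots> = (\<Sum>p | p permutes S. \<Sum>b\<in>insert n S. F (Flatten n (transpose n b \<circ> p)))"
    by (rule sum.swap)
  also have "\<dots> = (\<Sum>p | p permutes S. F' (Flatten (Suc m) p))"
    using n(2) step by (intro sum.cong refl) (simp add: S_def)
  also have "\<dots> = (\<Sum>u\<in>permutations_of_set A. of_nat (rl_weight u) * F' (1 # u))"
    unfolding S_def A_def by (rule Suc.IH)
  also have "\<dots> = (\<Sum>u\<in>permutations_of_set A. \<Sum>i\<le>length u.
      of_nat (rl_weight (take i u @ n # drop i u)) * F (1 # (take i u @ n # drop i u)))"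
  proof (rule sum.cong[OF refl])
    fix u assume u: "u \<in> permutations_of_set A"
    have w: "rl_weight (take i u @ n # drop i u) = (if i = length u then 2 else 1) * rl_weight u"
      if "i \<le> length u" for i
      using rl_weight_insert_greatest[of "take i u" "drop i u" n] permutations_of_setD(1)[OF u] that
      by (auto simp: A_def n_def)
    \<comment> \<open>At \<open>i = length u\<close> insertion after the last letter and the fixed
      point \<open>n\<close> give the same word; this is the extra factor 2 in the weight.\<close>
    have "(\<Sum>i\<le>length u.
      of_nat (rl_weight (take i u @ n # drop i u)) * F (1 # (take i u @ n # drop i u))) =
      (\<Sum>i\<le>length u. of_nat (rl_weight u) * F (1 # (take i u @ n # drop i u)) +
         (if i = length u then of_nat (rl_weight u) * F (1 # u @ [n]) else 0))"
      by (intro sum.cong refl) (auto simp: w mult_2 distrib_right distrib_left mult.assoc)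
    also have "\<dots> = of_nat (rl_weight u) * F' (1 # u)"
      unfolding F'[OF u]
      by (simp add: sum.distrib distrib_left sum_distrib_left add.commute)
    finally show "of_nat (rl_weight u) * F' (1 # u) = (\<Sum>i\<le>length u.
      of_nat (rl_weight (take i u @ n # drop i u)) * F (1 # (take i u @ n # drop i u)))" ..
  qed
  also have "\<dots> = (\<Sum>u\<in>permutations_of_set {2..n}. of_nat (rl_weight u) * F (1 # u))"
    unfolding n(3) by (rule sum_permutations_of_set_insert[symmetric, OF n(4)])
  finally show ?case unfolding n_def .
qed

section \<open>Counting the pattern from the left\<close>

lemma occ_13_2_singleton: "occ_13_2 [x] = 0"
proof -
  have "{(i, j). 2 \<le> i \<and> i < j \<and> j \<le> length [x] \<and>
      letter [x] (i - 1) < letter [x] j \<and> letter [x] j < letter [x] i} = {}"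
    by auto
  then show ?thesis unfolding occ_13_2_def by (simp only: card.empty)
qed

text \<open>Occurrences with \<open>i = 2\<close> use the ascent from \<open>x\<close> to
  \<open>y\<close> and a letter of \<open>w\<close> between them. All others are occurrences in
  \<open>y # w\<close> with both indices raised by one.\<close>

lemma occ_13_2_Cons:
  "occ_13_2 (x # y # w) = length (filter (\<lambda>z. x < z \<and> z < y) w) + occ_13_2 (y # w)"
proof -
  define Oc where "Oc w = {(i, j). 2 \<le> i \<and> i < j \<and> j \<le> length w \<and>
      letter w (i - 1) < letter w j \<and> letter w j < letter w i}" for w
  define K where "K = {k. k < length w \<and> x < w ! k \<and> w ! k < y}"
  have fin: "finite (Oc v)" for v
    by (rule finite_subset[of _ "{..length v} \<times> {..length v}"]) (auto simp: Oc_def)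
  have shift: "letter (x # y # w) (Suc i) = letter (y # w) i" if "i \<ge> 1" for i
    using that by (cases i) (auto simp: letter_def)
  \<comment> \<open>List index \<open>k\<close> of \<open>w\<close> is position \<open>k + 3\<close>
    of the whole word: two letters precede \<open>w\<close>, and positions start at 1.\<close>
  have "Oc (x # y # w) = (\<lambda>k. (2, k + 3)) ` K \<union> map_prod Suc Suc ` Oc (y # w)"
  proof (intro equalityI subsetI)
    fix t assume t: "t \<in> Oc (x # y # w)"
    obtain i j where ij: "t = (i, j)" by fastforce
    show "t \<in> (\<lambda>k. (2, k + 3)) ` K \<union> map_prod Suc Suc ` Oc (y # w)"
    proof (cases "i = 2")
      case True
      with t have "3 \<le> j" by (auto simp: Oc_def ij)
      then obtain k where k: "j = k + 3" using le_Suc_ex[of 3 j] by auto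
      have "k \<in> K"
        using t True by (simp add: Oc_def K_def ij k letter_def)
      with True ij k show ?thesis by auto
    next
      case False
      with t have "3 \<le> i" "i < j" by (auto simp: Oc_def ij)
      then obtain k l where kl: "i = Suc (Suc k)" "1 \<le> k" "j = Suc l"
        by (metis Suc_le_D Suc_le_eq less_imp_Suc_add numeral_3_eq_3 One_nat_def Suc_le_mono)
      have "(Suc k, l) \<in> Oc (y # w)"
        using t kl shift[of k] shift[of "Suc k"] shift[of l] by (auto simp: Oc_def ij)
      then show ?thesis using ij kl by (metis UnI2 image_eqI map_prod_simp)
    qed
  next
    fix t assume "t \<in> (\<lambda>k. (2, k + 3)) ` K \<union> map_prod Suc Suc ` Oc (y # w)"
    then show "t \<in> Oc (x # y # w)"
    proof
      assume "t \<in> (\<lambda>k. (2, k + 3)) ` K"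
      then show ?thesis by (auto simp: Oc_def K_def letter_def numeral_2_eq_2 numeral_3_eq_3)
    next
      assume "t \<in> map_prod Suc Suc ` Oc (y # w)"
      then obtain i j where ij: "t = (Suc i, Suc j)" "(i, j) \<in> Oc (y # w)" by auto
      then show ?thesis
        using shift[of i] shift[of j] shift[of "i - 1"] by (auto simp: Oc_def)
    qed
  qed
  moreover have "(\<lambda>k. (2, k + 3)) ` K \<inter> map_prod Suc Suc ` Oc (y # w) = {}"
    by (auto simp: Oc_def)
  moreover have "finite K" by (auto simp: K_def)
  moreover have "card ((\<lambda>k. (2::nat, k + 3)) ` K) = card K"
    by (rule card_image) (auto simp: inj_on_def)
  moreover have "card (map_prod Suc Suc ` Oc (y # w)) = card (Oc (y # w))"
    by (rule card_image) (auto simp: inj_on_def)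
  ultimately have "card (Oc (x # y # w)) = card K + card (Oc (y # w))"
    using fin[of "y # w"] \<open>finite K\<close> by (simp add: card_Un_disjoint)
  then show ?thesis
    by (simp add: occ_13_2_def Oc_def K_def length_filter_conv_card)
qed

section \<open>Removing the first letter\<close>

text \<open>
  In \<open>q ^ (b - r)\<close> the truncated subtraction is intended: a descent from rank \<open>r\<close> to a rank
  \<open>b < r\<close> creates no occurrence of the pattern. The factor 2 is for a first letter that is a
  right-to-left minimum.
\<close>

fun word_gf :: "nat \<Rightarrow> nat \<Rightarrow> rat poly" where
  "word_gf 0 r = 1"
| "word_gf (Suc m) r = (\<Sum>b\<le>m. q ^ (b - r) * (if b = 0 then 2 else 1) * word_gf m b)"

lemma sum_permutations_of_set_Cons:
  assumes "finite A" "A \<noteq> {}"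
  shows "(\<Sum>w\<in>permutations_of_set A. F w) =
    (\<Sum>a\<in>A. \<Sum>u\<in>permutations_of_set (A - {a}). F (a # u))"
proof -
  have "(\<Sum>w\<in>permutations_of_set A. F w) =
      (\<Sum>a\<in>A. \<Sum>w\<in>(#) a ` permutations_of_set (A - {a}). F w)"
    unfolding permutations_of_set_nonempty[OF assms(2)]
    using assms by (intro sum.UNION_disjoint) auto
  then show ?thesis by (simp add: sum.reindex)
qed

text \<open>The rank is strictly monotone, hence injective, and takes values in a set of size
  \<open>card A\<close>. It serves to sum over ranks instead of first letters.\<close>

lemma bij_betw_rank:
  fixes A :: "'a :: linorder set"
  assumes "finite A"
  shows "bij_betw (\<lambda>a. card {y \<in> A. y < a}) A {..<card A}"
proof -
  let ?rk = "\<lambda>a. card {y \<in> A. y < a}"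
  have mono: "?rk a < ?rk b" if "a \<in> A" "b \<in> A" "a < b" for a b
    using that assms by (intro psubset_card_mono) auto
  have inj: "inj_on ?rk A"
    by (rule linorder_inj_onI') (use mono in force)
  have "?rk ` A \<subseteq> {..<card A}"
    using assms by (auto intro!: psubset_card_mono)
  then have "?rk ` A = {..<card A}"
    by (rule card_subset_eq[OF finite_lessThan]) (simp add: card_image[OF inj])
  with inj show ?thesis by (simp add: bij_betw_def)
qed

text \<open>Only the size of \<open>A\<close> and the rank of \<open>x\<close> matter. A first
  letter \<open>a\<close> is a right-to-left minimum exactly at rank 0, and the letters between
  \<open>x\<close> and \<open>a\<close> are counted by a difference of ranks.\<close>

lemma sum_rl_weight_occ:
  assumes "finite A" "x \<notin> A"
  shows "(\<Sum>u\<in>permutations_of_set A. of_nat (rl_weight u) * q ^ occ_13_2 (x # u)) =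
    word_gf (card A) (card {y \<in> A. y < x})"
  using assms
proof (induction "card A" arbitrary: A x)
  case 0
  then show ?case by (simp add: occ_13_2_singleton)
next
  case (Suc m)
  define rk where "rk a = card {y \<in> A. y < a}" for a
  have above: "a < z \<longleftrightarrow> \<not> z < a" if "a \<notin> A'" "z \<in> A'" for a z :: nat and A'
    using that by (metis linorder_neqE_nat less_asym)
  have "A \<noteq> {}" using Suc by auto
  have "(\<Sum>u\<in>permutations_of_set A. of_nat (rl_weight u) * q ^ occ_13_2 (x # u)) =
      (\<Sum>a\<in>A. \<Sum>u\<in>permutations_of_set (A - {a}).
        of_nat (rl_weight (a # u)) * q ^ occ_13_2 (x # a # u))"
    by (rule sum_permutations_of_set_Cons[OF \<open>finite A\<close> \<open>A \<noteq> {}\<close>])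
  also have "\<dots> = (\<Sum>a\<in>A. q ^ (rk a - rk x) * (if rk a = 0 then 2 else 1) * word_gf m (rk a))"
  proof (rule sum.cong[OF refl])
    fix a assume a: "a \<in> A"
    have between: "card {z \<in> A - {a}. x < z \<and> z < a} = rk a - rk x"
    proof (cases "x < a")
      case True
      then have eq: "{z \<in> A - {a}. x < z \<and> z < a} = {y \<in> A. y < a} - {y \<in> A. y < x}"
        using above[OF \<open>x \<notin> A\<close>] by auto
      show ?thesis
        unfolding rk_def eq by (rule card_Diff_subset) (use True \<open>finite A\<close> in auto)
    next
      case False
      then have "{z \<in> A - {a}. x < z \<and> z < a} = {}" by auto
      moreover have "rk a \<le> rk x"
        unfolding rk_def by (rule card_mono) (use False \<open>finite A\<close> in auto)
      ultimately show ?thesis by (simp only: card.empty)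
    qed
    have wt: "of_nat (rl_weight (a # u)) * q ^ occ_13_2 (x # a # u) =
        q ^ (rk a - rk x) * (if rk a = 0 then 2 else 1) *
          (of_nat (rl_weight u) * q ^ occ_13_2 (a # u))"
      if u: "u \<in> permutations_of_set (A - {a})" for u
    proof -
      have su: "set u = A - {a}" and du: "distinct u" using permutations_of_setD[OF u] .
      have "(\<forall>y\<in>set u. a < y) \<longleftrightarrow> rk a = 0"
        unfolding rk_def su using above[of a "A - {a}"] \<open>finite A\<close> by auto
      moreover have "length (filter (\<lambda>z. x < z \<and> z < a) u) = rk a - rk x"
        using distinct_card[of "filter (\<lambda>z. x < z \<and> z < a) u"] du between
        by (simp add: su)
      ultimately show ?thesis
        by (simp add: occ_13_2_Cons power_add algebra_simps)
    qed
    \<comment> \<open>Removing \<open>a\<close> does not change its own rank, so the induction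
      hypothesis applies with that rank.\<close>
    have "{y \<in> A - {a}. y < a} = {y \<in> A. y < a}" by auto
    moreover have "m = card (A - {a})" using Suc a by simp
    ultimately have "(\<Sum>u\<in>permutations_of_set (A - {a}).
        of_nat (rl_weight u) * q ^ occ_13_2 (a # u)) = word_gf m (rk a)"
      using Suc.hyps(1)[of "A - {a}" a] Suc.prems unfolding rk_def by simp
    then show "(\<Sum>u\<in>permutations_of_set (A - {a}).
        of_nat (rl_weight (a # u)) * q ^ occ_13_2 (x # a # u)) =
        q ^ (rk a - rk x) * (if rk a = 0 then 2 else 1) * word_gf m (rk a)"
      by (simp only: wt sum_distrib_left[symmetric] cong: sum.cong)
  qed
  also have "\<dots> = (\<Sum>b\<le>m. q ^ (b - rk x) * (if b = 0 then 2 else 1) * word_gf m b)"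
    using sum.reindex_bij_betw[OF bij_betw_rank[OF \<open>finite A\<close>], folded rk_def,
        of "\<lambda>b. q ^ (b - rk x) * (if b = 0 then 2 else 1) * word_gf m b"]
    unfolding Suc.hyps(2)[symmetric] lessThan_Suc_atMost .
  finally show ?case unfolding Suc.hyps(2)[symmetric] rk_def by simp
qed

lemma g_eq_word_gf: "g (Suc m) = word_gf m 0"
proof -
  have "card {y \<in> {2..Suc m}. y < 1} = 0" by (auto simp: card_eq_0_iff)
  then show ?thesis
    using sum_Flatten[of "\<lambda>w. q ^ occ_13_2 w" m] sum_rl_weight_occ[of "{2..Suc m}" 1]
    by (simp only: g_def) simp
qed

section \<open>Differences in the rank\<close>

definition word_gf_diff :: "nat \<Rightarrow> nat \<Rightarrow> rat poly" where
  "word_gf_diff m r = word_gf m (Suc r) - word_gf m r"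

text \<open>For \<open>r \<ge> 1\<close> this is the part of the sum for
  \<open>word_gf (Suc m) r\<close> with \<open>b \<ge> r\<close>, where the exponent is not
  truncated and the factor 2 is absent.\<close>

definition word_gf_tail :: "nat \<Rightarrow> nat \<Rightarrow> rat poly" where
  "word_gf_tail m r = (\<Sum>b = r..m. q ^ (b - r) * word_gf m b)"

lemma power_diff_Suc: "r < b \<Longrightarrow> x ^ (b - r) = x * x ^ (b - Suc r)" for x :: "'a :: monoid_mult"
  by (metis Suc_diff_Suc power_Suc)

lemma word_gf_tail_rec: "r \<le> m \<Longrightarrow> word_gf_tail m r = word_gf m r + q * word_gf_tail m (Suc r)"
proof -
  assume r: "r \<le> m"
  have "word_gf_tail m r = word_gf m r + (\<Sum>b = Suc r..m. q ^ (b - r) * word_gf m b)"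
    unfolding word_gf_tail_def using r by (simp add: sum.atLeast_Suc_atMost)
  also have "(\<Sum>b = Suc r..m. q ^ (b - r) * word_gf m b) = q * word_gf_tail m (Suc r)"
    unfolding word_gf_tail_def sum_distrib_left
    by (intro sum.cong refl) (simp add: power_diff_Suc mult.assoc)
  finally show ?thesis .
qed

text \<open>Summands with \<open>b \<le> r\<close> have exponent 0 at both ranks and cancel; for
  larger \<open>b\<close> the exponents differ by one.\<close>

lemma word_gf_diff_Suc: "word_gf_diff (Suc m) r = - ((q - 1) * word_gf_tail m (Suc r))"
proof -
  have "word_gf_diff (Suc m) r =
      (\<Sum>b\<le>m. if Suc r \<le> b then - ((q - 1) * (q ^ (b - Suc r) * word_gf m b)) else 0)"
    unfolding word_gf_diff_def word_gf.simps sum_subtractf[symmetric]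
  proof (intro sum.cong refl)
    fix b
    have "q ^ (b - r) = q * q ^ (b - Suc r)" if "Suc r \<le> b"
      using that by (simp add: power_diff_Suc)
    then show "q ^ (b - Suc r) * (if b = 0 then 2 else 1) * word_gf m b -
        q ^ (b - r) * (if b = 0 then 2 else 1) * word_gf m b =
        (if Suc r \<le> b then - ((q - 1) * (q ^ (b - Suc r) * word_gf m b)) else 0)"
      by (auto simp: algebra_simps)
  qed
  also have "\<dots> = (\<Sum>b = Suc r..m. - ((q - 1) * (q ^ (b - Suc r) * word_gf m b)))"
    by (intro sum.mono_neutral_cong_right) auto
  finally show ?thesis unfolding word_gf_tail_def by (simp add: sum_distrib_left sum_negf)
qed

lemma word_gf_diff_rec:
  assumes "1 \<le> r" "r \<le> m"
  shows "q * word_gf_diff (Suc m) r = word_gf_diff (Suc m) (r - 1) + (q - 1) * word_gf m r"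
  using assms word_gf_tail_rec[of r m] by (simp add: word_gf_diff_Suc algebra_simps)

text \<open>The start of the recursion in \<open>r\<close>; the factor 2 comes from the weight of
  the first letter of rank 0.\<close>

lemma word_gf_diff_0: "q * word_gf_diff (Suc m) 0 =
    2 * (q - 1) * word_gf m 0 - (q - 1) * word_gf (Suc m) 0"
proof -
  have "word_gf (Suc m) 0 = 2 * word_gf m 0 + (\<Sum>b = 1..m. q ^ b * word_gf m b)"
    by (simp add: atMost_atLeast0 sum.atLeast_Suc_atMost del: word_gf.simps add: word_gf.simps(2))
  also have "(\<Sum>b = 1..m. q ^ b * word_gf m b) = q * word_gf_tail m 1"
    unfolding word_gf_tail_def sum_distrib_left
  proof (intro sum.cong refl)
    fix b assume "b \<in> {1..m}"
    then show "q ^ b * word_gf m b = q * (q ^ (b - 1) * word_gf m b)" by (cases b) auto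
  qed
  finally show ?thesis by (simp add: word_gf_diff_Suc algebra_simps del: word_gf.simps)
qed

text \<open>At ranks \<open>m\<close> and \<open>Suc m\<close> at most one of the
  \<open>Suc m\<close> letters lies above the preceding letter, so no occurrence begins
  there.\<close>

lemma word_gf_diff_last: "word_gf_diff (Suc m) m = 0"
  by (simp add: word_gf_diff_Suc word_gf_tail_def)

section \<open>Expansion in the values at rank 0\<close>

text \<open>
  For \<open>1 \<le> j \<le> N\<close> this is \<open>(N + j) / j\<close> times \<open>N - 1\<close> over \<open>j - 1\<close>. With \<open>N = n - 1 - k\<close> it
  accounts for the first and the last factor of the coefficient of \<open>q ^ k\<close> in \<open>b_coeff n j\<close>.
\<close>

fun lucas_binomial :: "nat \<Rightarrow> nat \<Rightarrow> nat" where
  "lucas_binomial 0 j = (if j = 0 then 1 else 0)"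
| "lucas_binomial (Suc N) j = (Suc N choose j) + (if j = 0 then 0 else N choose (j - 1))"

text \<open>The coefficient of \<open>x ^ k\<close> in the power series of \<open>(1 - x)\<close> to
  the exponent \<open>-j\<close>.\<close>

definition multichoose :: "nat \<Rightarrow> nat \<Rightarrow> nat" where
  "multichoose j k = (if j = 0 then if k = 0 then 1 else 0 else (j - 1 + k) choose k)"

text \<open>With \<open>a = Suc r\<close>, the coefficient of
  \<open>(q - 1) ^ j * word_gf (m - j) 0\<close> in \<open>q ^ r * word_gf m r\<close>.\<close>

definition word_gf_coeff :: "nat \<Rightarrow> nat \<Rightarrow> rat poly" where
  "word_gf_coeff a j = (\<Sum>k<a. of_nat (multichoose j k * lucas_binomial (a - 1 - k) j) * q ^ k)"

text \<open>The same for \<open>q ^ Suc r * word_gf_diff m r\<close>, for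
  \<open>j \<ge> 1\<close>.\<close>

definition diff_coeff :: "nat \<Rightarrow> nat \<Rightarrow> rat poly" where
  "diff_coeff a j = (\<Sum>k<a. of_nat (multichoose (j - 1) k * lucas_binomial (a - k) j) * q ^ k)"

lemma lucas_binomial_eq_0: "N < j \<Longrightarrow> lucas_binomial N j = 0"
  by (cases N) auto

text \<open>Pascal's rule. The excluded case \<open>N = 0\<close>, \<open>j = 1\<close> fails, with
  2 on the left and 1 on the right.\<close>

lemma lucas_binomial_Suc: "1 \<le> j \<Longrightarrow> 1 \<le> N \<or> 2 \<le> j \<Longrightarrow>
    lucas_binomial (Suc N) j = lucas_binomial N j + lucas_binomial N (j - 1)"
  by (cases N; cases j; cases "j - 1") (auto simp: binomial_eq_0)

lemma multichoose_Suc: "multichoose (Suc j) (Suc k) =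
    multichoose (Suc j) k + multichoose j (Suc k)"
  by (cases j) (auto simp: multichoose_def)

lemma multichoose_0_right [simp]: "multichoose j 0 = 1"
  by (simp add: multichoose_def)

lemma word_gf_coeff_0: "1 \<le> a \<Longrightarrow> word_gf_coeff a 0 = 1"
proof -
  assume "1 \<le> a"
  have e0: "lucas_binomial N 0 = 1" for N by (cases N) auto
  have "word_gf_coeff a 0 = (\<Sum>k<a. if k = 0 then 1 else 0)"
    unfolding word_gf_coeff_def by (intro sum.cong refl) (auto simp: multichoose_def e0)
  then show ?thesis using \<open>1 \<le> a\<close> by simp
qed

lemma word_gf_coeff_eq_0: "1 \<le> j \<Longrightarrow> a \<le> j \<Longrightarrow> word_gf_coeff a j = 0"
  unfolding word_gf_coeff_def by (intro sum.neutral) (auto simp: lucas_binomial_eq_0)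

lemma diff_coeff_1_1: "diff_coeff 1 1 = 2"
  by (simp add: diff_coeff_def)

lemma diff_coeff_eq_0: "a < j \<Longrightarrow> diff_coeff a j = 0"
  unfolding diff_coeff_def by (intro sum.neutral) (auto simp: lucas_binomial_eq_0)

text \<open>Splitting by \<open>multichoose_Suc\<close> mirrors
  \<open>word_gf m (Suc r) = word_gf m r + word_gf_diff m r\<close> after multiplication by
  \<open>q ^ Suc r\<close>.\<close>

lemma word_gf_coeff_Suc:
  assumes "1 \<le> j"
  shows "word_gf_coeff (Suc a) j = q * word_gf_coeff a j + diff_coeff a j"
proof -
  obtain i where j: "j = Suc i" using assms by (cases j) auto
  have "word_gf_coeff (Suc a) j = of_nat (lucas_binomial a j) +
      (\<Sum>k<a. of_nat (multichoose j (Suc k) * lucas_binomial (a - Suc k) j) * q ^ Suc k)"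
    unfolding word_gf_coeff_def
        by (simp add: sum.lessThan_Suc_shift del: sum.lessThan_Suc power_Suc)
  also have "(\<Sum>k<a. of_nat (multichoose j (Suc k) * lucas_binomial (a - Suc k) j) * q ^ Suc k) =
      q * word_gf_coeff a j +
          (\<Sum>k<a. of_nat (multichoose i (Suc k) * lucas_binomial (a - Suc k) j) * q ^ Suc k)"
    unfolding word_gf_coeff_def sum_distrib_left sum.distrib[symmetric] j
    by (intro sum.cong refl) (simp add: multichoose_Suc algebra_simps)
  also have "of_nat (lucas_binomial a j) + (q * word_gf_coeff a j +
      (\<Sum>k<a. of_nat (multichoose i (Suc k) * lucas_binomial (a - Suc k) j) * q ^ Suc k)) =
      q * word_gf_coeff a j +
          (\<Sum>k<Suc a. of_nat (multichoose i k * lucas_binomial (a - k) j) * q ^ k)"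
    by (simp add: sum.lessThan_Suc_shift del: sum.lessThan_Suc power_Suc)
  \<comment> \<open>The term \<open>k = a\<close> vanishes because
    \<open>lucas_binomial 0 j = 0\<close> for \<open>j \<ge> 1\<close>.\<close>
  also have "(\<Sum>k<Suc a. of_nat (multichoose i k * lucas_binomial (a - k) j) * q ^ k) =
      diff_coeff a j"
    by (simp add: diff_coeff_def j)
  finally show ?thesis .
qed

text \<open>Pascal's rule for \<open>lucas_binomial\<close>, applied termwise, mirrors
  \<open>word_gf_diff_rec\<close>.\<close>

lemma diff_coeff_Suc:
  assumes "1 \<le> j" "1 \<le> a"
  shows "diff_coeff (Suc a) j = diff_coeff a j + word_gf_coeff (Suc a) (j - 1)"
proof -
  have "diff_coeff (Suc a) j =
      (\<Sum>k<Suc a. of_nat (multichoose (j - 1) k * lucas_binomial (a - k) j) * q ^ k +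
      of_nat (multichoose (j - 1) k * lucas_binomial (a - k) (j - 1)) * q ^ k)"
    unfolding diff_coeff_def
  proof (intro sum.cong refl)
    fix k assume k: "k \<in> {..<Suc a}"
    show "of_nat (multichoose (j - 1) k * lucas_binomial (Suc a - k) j) * q ^ k =
        of_nat (multichoose (j - 1) k * lucas_binomial (a - k) j) * q ^ k +
        of_nat (multichoose (j - 1) k * lucas_binomial (a - k) (j - 1)) * q ^ k"
    proof (cases "k = a \<and> j = 1")
      \<comment> \<open>Pascal's rule fails here, but \<open>multichoose 0 a = 0\<close> since
        \<open>a \<ge> 1\<close>.\<close>
      case True
      then show ?thesis using assms by (simp add: multichoose_def)
    next
      case False
      then have "lucas_binomial (Suc (a - k)) j = lucas_binomial (a - k) j +
          lucas_binomial (a - k) (j - 1)"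
        using assms k by (intro lucas_binomial_Suc) auto
      moreover have "Suc a - k = Suc (a - k)" using k by auto
      ultimately show ?thesis by (simp add: algebra_simps)
    qed
  qed
  also have "\<dots> = diff_coeff a j + word_gf_coeff (Suc a) (j - 1)"
    unfolding sum.distrib using assms by (simp add: diff_coeff_def word_gf_coeff_def)
  finally show ?thesis .
qed

lemma b_coeff_eq_diff_coeff:
  assumes "1 \<le> j" "j < n"
  shows "b_coeff n j = diff_coeff (n - 1) j"
proof -
  have coeff: "(of_nat n - 1 + of_nat j - of_nat k) / of_nat j
               * of_nat (binom (int j + int k - 2) (int j - 2))
               * of_nat (binom (int n - 2 - int k) (int j - 1)) =
        (of_nat (multichoose (j - 1) k * lucas_binomial (n - 1 - k) j) :: rat)"
    if k: "k \<le> n - 1 - j" for k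
  proof -
    obtain N where N: "n = k + N + 2" "j \<le> Suc N"
      using k assms by (intro that[of "n - k - 2"]) linarith+
    obtain i where i: "j = Suc i" using assms by (cases j) auto
    have 1: "binom (int j + int k - 2) (int j - 2) = multichoose (j - 1) k"
    proof (cases i)
      \<comment> \<open>For \<open>j = 1\<close> the convention for \<open>-1\<close> over
        \<open>-1\<close> gives 1 at \<open>k = 0\<close> and 0 otherwise, as does
        \<open>multichoose 0 k\<close>.\<close>
      case 0
      then show ?thesis by (auto simp: binom_def multichoose_def i)
    next
      case (Suc h)
      have "int j + int k - 2 = int (h + k)" "int j - 2 = int h" by (simp_all add: i Suc)
      then show ?thesis
        using binomial_symmetric[of h "h + k"]
        by (simp add: binom_def multichoose_def i Suc nat_add_distrib)
    qed
    have "int n - 2 - int k = int N" "int j - 1 = int i" by (simp_all add: i N)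
    then have 2: "binom (int n - 2 - int k) (int j - 1) = N choose i"
      using N(2) i by (simp add: binom_def)
    \<comment> \<open>Absorption turns \<open>Suc N / j\<close> times \<open>N choose i\<close> into
      \<open>Suc N choose j\<close>; the rest of the fraction, \<open>j / j\<close>, gives the
      second summand of \<open>lucas_binomial\<close>.\<close>
    have "of_nat (Suc N * (N choose i)) = (of_nat (Suc i * (Suc N choose Suc i)) :: rat)"
      by (simp only: Suc_times_binomial_eq mult.commute)
    then have "(of_nat n - 1 + of_nat j - of_nat k) / of_nat j * of_nat (N choose i) =
        (of_nat (lucas_binomial (Suc N) j) :: rat)"
      by (simp add: i N field_simps del: binomial_Suc_Suc)
    moreover have "n - 1 - k = Suc N" using N by simp
    ultimately show ?thesis unfolding 1 2 by (metis mult.assoc mult.commute of_nat_mult)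
  qed
  have "b_coeff n j =
      (\<Sum>k = 0..n - 1 - j. of_nat (multichoose (j - 1) k * lucas_binomial (n - 1 - k) j) * q ^ k)"
    unfolding b_coeff_def by (intro sum.cong refl)
        (simp only: coeff atLeastAtMost_iff of_nat_mult_conv_smult)
  \<comment> \<open>The additional terms have \<open>n - 1 - k < j\<close>, where
    \<open>lucas_binomial\<close> is 0.\<close>
  also have "\<dots> = diff_coeff (n - 1) j"
    unfolding diff_coeff_def using assms
    by (intro sum.mono_neutral_left) (auto simp: lucas_binomial_eq_0)
  finally show ?thesis .
qed

text \<open>Both expansions are proved together: the one for \<open>word_gf\<close> at rank
  \<open>Suc r\<close> uses both at rank \<open>r\<close>, and the one for
  \<open>word_gf_diff\<close> then also uses the new \<open>word_gf\<close> expansion with one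
  letter fewer. The powers of \<open>q\<close> avoid division.\<close>

lemma word_gf_expansion:
  "(\<forall>m\<ge>r. q ^ r * word_gf m r =
      (\<Sum>j\<le>r. (q - 1) ^ j * word_gf_coeff (Suc r) j * word_gf (m - j) 0)) \<and>
   (\<forall>m>r. q ^ Suc r * word_gf_diff m r =
     - (q - 1) * word_gf m 0 +
         (\<Sum>j\<le>r. (q - 1) ^ Suc j * diff_coeff (Suc r) (Suc j) * word_gf (m - Suc j) 0))"
proof (induction r)
  case 0
  have "q ^ Suc 0 * word_gf_diff m 0 = - (q - 1) * word_gf m 0 +
      (q - 1) * diff_coeff 1 1 * word_gf (m - 1) 0" if "0 < m" for m
    using that word_gf_diff_0[of "m - 1"] diff_coeff_1_1 by (simp add: algebra_simps)
  then show ?case by (simp add: word_gf_coeff_0)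
next
  case (Suc r)
  then have IH_gf: "q ^ r * word_gf m r =
      (\<Sum>j\<le>r. (q - 1) ^ j * word_gf_coeff (Suc r) j * word_gf (m - j) 0)"
    if "r \<le> m" for m using that by blast
  from Suc have IH_diff: "q ^ Suc r * word_gf_diff m r =
     - (q - 1) * word_gf m 0 +
         (\<Sum>j\<le>r. (q - 1) ^ Suc j * diff_coeff (Suc r) (Suc j) * word_gf (m - Suc j) 0)"
    if "r < m" for m using that by blast
  have gf: "q ^ Suc r * word_gf m (Suc r) =
      (\<Sum>j\<le>Suc r. (q - 1) ^ j * word_gf_coeff (Suc (Suc r)) j * word_gf (m - j) 0)"
    if "Suc r \<le> m" for m
  proof -
    \<comment> \<open>The added term \<open>j = Suc r\<close> is 0; splitting off
      \<open>j = 0\<close> then aligns the sum with that of \<open>IH_diff\<close>.\<close>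
    have "(\<Sum>j\<le>r. (q - 1) ^ j * word_gf_coeff (Suc r) j * word_gf (m - j) 0) =
        (\<Sum>j\<le>Suc r. (q - 1) ^ j * word_gf_coeff (Suc r) j * word_gf (m - j) 0)"
      by (simp add: word_gf_coeff_eq_0)
    also have "\<dots> = word_gf m 0 +
        (\<Sum>j\<le>r. (q - 1) ^ Suc j * word_gf_coeff (Suc r) (Suc j) * word_gf (m - Suc j) 0)"
      unfolding sum.atMost_Suc_shift by (simp add: word_gf_coeff_0)
    finally have gf_r: "q ^ r * word_gf m r = \<dots>" using IH_gf[of m] that by simp
    have "q ^ Suc r * word_gf m (Suc r) = q * (q ^ r * word_gf m r) +
        q ^ Suc r * word_gf_diff m r"
      by (simp add: word_gf_diff_def algebra_simps)
    also have "\<dots> = word_gf m 0 +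
        (\<Sum>j\<le>r. q * ((q - 1) ^ Suc j * word_gf_coeff (Suc r) (Suc j) * word_gf (m - Suc j) 0) +
          (q - 1) ^ Suc j * diff_coeff (Suc r) (Suc j) * word_gf (m - Suc j) 0)"
      unfolding gf_r using IH_diff[of m] that
      by (simp add: sum.distrib sum_distrib_left algebra_simps del: power_Suc)
    also have "\<dots> = word_gf m 0 +
        (\<Sum>j\<le>r. (q - 1) ^ Suc j * word_gf_coeff (Suc (Suc r)) (Suc j) * word_gf (m - Suc j) 0)"
      by (intro arg_cong2[of _ _ _ _ "(+)"] sum.cong refl)
          (simp add: word_gf_coeff_Suc algebra_simps)
    also have "\<dots> = (\<Sum>j\<le>Suc r. (q - 1) ^ j * word_gf_coeff (Suc (Suc r)) j * word_gf (m - j) 0)"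
      unfolding sum.atMost_Suc_shift by (simp add: word_gf_coeff_0)
    finally show ?thesis .
  qed
  have "q ^ Suc (Suc r) * word_gf_diff m (Suc r) = - (q - 1) * word_gf m 0 +
      (\<Sum>j\<le>Suc r. (q - 1) ^ Suc j * diff_coeff (Suc (Suc r)) (Suc j) * word_gf (m - Suc j) 0)"
    if m': "Suc r < m" for m
  proof -
    obtain k where m: "m = Suc k" and k: "Suc r \<le> k" using m' by (cases m) auto
    have "q ^ Suc (Suc r) * word_gf_diff m (Suc r) = q ^ Suc r * (q * word_gf_diff m (Suc r))"
      by (simp add: algebra_simps)
    also have "\<dots> = q ^ Suc r * word_gf_diff m r + (q - 1) * (q ^ Suc r * word_gf k (Suc r))"
      unfolding m word_gf_diff_rec[OF _ k, simplified] by (simp add: algebra_simps)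
    also have "q ^ Suc r * word_gf_diff m r =
        - (q - 1) * word_gf m 0 +
            (\<Sum>j\<le>Suc r. (q - 1) ^ Suc j * diff_coeff (Suc r) (Suc j) * word_gf (m - Suc j) 0)"
      using IH_diff[of m] m' by (simp add: diff_coeff_eq_0)
    also have "(q - 1) * (q ^ Suc r * word_gf k (Suc r)) =
        (\<Sum>j\<le>Suc r. (q - 1) ^ Suc j * word_gf_coeff (Suc (Suc r)) j * word_gf (m - Suc j) 0)"
      unfolding gf[OF k] sum_distrib_left by (simp add: m mult.assoc del: sum.atMost_Suc)
    also have "- (q - 1) * word_gf m 0 +
        (\<Sum>j\<le>Suc r. (q - 1) ^ Suc j * diff_coeff (Suc r) (Suc j) * word_gf (m - Suc j) 0) +
        (\<Sum>j\<le>Suc r. (q - 1) ^ Suc j * word_gf_coeff (Suc (Suc r)) j * word_gf (m - Suc j) 0) =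
        - (q - 1) * word_gf m 0 +
            (\<Sum>j\<le>Suc r. (q - 1) ^ Suc j * diff_coeff (Suc (Suc r)) (Suc j) * word_gf (m - Suc j) 0)"
      unfolding add.assoc sum.distrib[symmetric]
      by (intro arg_cong2[of _ _ _ _ "(+)"] sum.cong refl)
          (simp add: diff_coeff_Suc algebra_simps)
    finally show ?thesis .
  qed
  with gf show ?case by blast
qed

theorem theorem2p2:
  fixes n :: nat
  assumes "n \<ge> 2"
  shows "g n = (\<Sum>j = 1..n - 1. b_coeff n j * (q - 1) ^ (j - 1) * g (n - j))"
proof -
  define m where "m = n - 2"
  have n: "n = Suc (Suc m)" using assms by (simp add: m_def)
  have q_neq_1: "q \<noteq> 1" by (simp add: q_def one_pCons)
  \<comment> \<open>The expansion of \<open>word_gf_diff (Suc m) m\<close>, whose left side is 0,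
    leaves this equation for its first term.\<close>
  have "(q - 1) * word_gf (Suc m) 0 =
      (\<Sum>j\<le>m. (q - 1) ^ Suc j * diff_coeff (Suc m) (Suc j) * word_gf (Suc m - Suc j) 0)"
    using conjunct2[OF word_gf_expansion[of m], rule_format, of "Suc m"]
    by (simp add: word_gf_diff_last algebra_simps del: word_gf.simps)
  also have "\<dots> = (q - 1) * (\<Sum>j\<le>m. diff_coeff (Suc m) (Suc j) * (q - 1) ^ j * word_gf (m - j) 0)"
    unfolding sum_distrib_left by (intro sum.cong refl) (simp add: algebra_simps)
  finally have "word_gf (Suc m) 0 =
      (\<Sum>j\<le>m. diff_coeff (Suc m) (Suc j) * (q - 1) ^ j * word_gf (m - j) 0)"
    using q_neq_1 by (simp del: word_gf.simps)
  also have "\<dots> = (\<Sum>j\<le>m. b_coeff n (Suc j) * (q - 1) ^ (Suc j - 1) * g (n - Suc j))"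
  proof (intro sum.cong refl)
    fix j assume "j \<in> {..m}"
    then have "g (n - Suc j) = word_gf (m - j) 0" using g_eq_word_gf[of "m - j"]
        by (simp add: n Suc_diff_le)
    then show "diff_coeff (Suc m) (Suc j) * (q - 1) ^ j * word_gf (m - j) 0 =
        b_coeff n (Suc j) * (q - 1) ^ (Suc j - 1) * g (n - Suc j)"
      using b_coeff_eq_diff_coeff[of "Suc j" n] \<open>j \<in> {..m}\<close> by (simp add: n)
  qed
  also have "\<dots> = (\<Sum>j = 1..n - 1. b_coeff n j * (q - 1) ^ (j - 1) * g (n - j))"
    by (rule sum.reindex_bij_witness[of _ "\<lambda>j. j - 1" Suc]) (auto simp: n)
  finally show ?thesis using g_eq_word_gf[of "Suc m"] n by simp
qed

end
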